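(* Every Eulerian bipartite graph $G$ with maximum degree $\Delta(G)\leq 8$ has a cyclic interval $\Delta(G)$-coloring.
   Context: All graphs are finite and undirected; multiple edges are allowed, loops are not. A graph is Eulerian if every vertex has even degree. A proper $t$-edge coloring of $G$ is a map $\alpha:E(G)\to\{1,\dots,t\}$ with $\alpha(e)\neq\alpha(e')$ for adjacent edges $e,e'$; $S(v,\alpha)$ is the set of colors on edges incident to $v$. A proper $t$-edge coloring $\alpha$ is a cyclic interval $t$-coloring if for every vertex $v$, either $S(v,\alpha)$ or $\{1,\dots,t\}\setminus S(v,\alpha)$ is a set of consecutive integers. *)

theory Defs
  imports Main
begin

text \<open>
  Undirected multigraphs: edges are abstract objects, and each edge is mapped to the set of
  its two end vertices. Distinct edges may have the same ends; since the ends of an edge form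
  a set of cardinality two, there are no loops.
\<close>

record ('v, 'e) pre_multigraph =
  verts :: "'v set"
  edges :: "'e set"
  ends :: "'e \<Rightarrow> 'v set"

locale finite_multigraph =
  fixes G :: "('v, 'e) pre_multigraph"
  assumes finite_verts: "finite (verts G)"
    and finite_edges: "finite (edges G)"
    and ends_subset: "e \<in> edges G \<Longrightarrow> ends G e \<subseteq> verts G"
    and card_ends: "e \<in> edges G \<Longrightarrow> card (ends G e) = 2"

definition incident_edges :: "('v, 'e) pre_multigraph \<Rightarrow> 'v \<Rightarrow> 'e set" where
  "incident_edges G v = {e \<in> edges G. v \<in> ends G e}"

definition degree :: "('v, 'e) pre_multigraph \<Rightarrow> 'v \<Rightarrow> nat" where
  "degree G v = card (incident_edges G v)"

text \<open>The inserted 0 only matters for the graph without vertices.\<close>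

definition max_degree :: "('v, 'e) pre_multigraph \<Rightarrow> nat" where
  "max_degree G = Max (insert 0 (degree G ` verts G))"

text \<open>Connectedness is not part of being Eulerian.\<close>

definition eulerian :: "('v, 'e) pre_multigraph \<Rightarrow> bool" where
  "eulerian G \<longleftrightarrow> (\<forall>v \<in> verts G. even (degree G v))"

definition bipartite :: "('v, 'e) pre_multigraph \<Rightarrow> bool" where
  "bipartite G \<longleftrightarrow>
    (\<exists>X Y. X \<union> Y = verts G \<and> X \<inter> Y = {} \<and>
      (\<forall>e \<in> edges G. \<exists>x \<in> X. \<exists>y \<in> Y. ends G e = {x, y}))"

definition adjacent_edges :: "('v, 'e) pre_multigraph \<Rightarrow> 'e \<Rightarrow> 'e \<Rightarrow> bool" where
  "adjacent_edges G e e' \<longleftrightarrow>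
    e \<in> edges G \<and> e' \<in> edges G \<and> e \<noteq> e' \<and> ends G e \<inter> ends G e' \<noteq> {}"

definition proper_edge_coloring ::
  "('v, 'e) pre_multigraph \<Rightarrow> nat \<Rightarrow> ('e \<Rightarrow> nat) \<Rightarrow> bool" where
  "proper_edge_coloring G t \<alpha> \<longleftrightarrow>
    (\<forall>e \<in> edges G. \<alpha> e \<in> {1..t}) \<and>
    (\<forall>e e'. adjacent_edges G e e' \<longrightarrow> \<alpha> e \<noteq> \<alpha> e')"

definition colors_at :: "('v, 'e) pre_multigraph \<Rightarrow> ('e \<Rightarrow> nat) \<Rightarrow> 'v \<Rightarrow> nat set" where
  "colors_at G \<alpha> v = \<alpha> ` incident_edges G v"

text \<open>
  The empty set counts as consecutive (take \<open>b < a\<close>). Below this makes no difference for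
  positive \<open>t\<close>, since the complement of the empty set in \<open>{1..t}\<close> is all of \<open>{1..t}\<close>; for
  \<open>t = 0\<close> it makes the empty coloring of an edgeless graph a cyclic interval coloring.
\<close>

definition consecutive :: "nat set \<Rightarrow> bool" where
  "consecutive A \<longleftrightarrow> (\<exists>a b. A = {a..b})"

definition cyclic_interval_coloring ::
  "('v, 'e) pre_multigraph \<Rightarrow> nat \<Rightarrow> ('e \<Rightarrow> nat) \<Rightarrow> bool" where
  "cyclic_interval_coloring G t \<alpha> \<longleftrightarrow>
    proper_edge_coloring G t \<alpha> \<and>
    (\<forall>v \<in> verts G. consecutive (colors_at G \<alpha> v) \<or> consecutive ({1..t} - colors_at G \<alpha> v))"

end

(*
  A bipartite graph with even degrees splits into two halves with equal degrees: pair the edges at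
  every vertex and colour alternately along the resulting even cycles. Reading one half as oriented
  from X to Y and the other from Y to X makes G a digraph with balanced in- and outdegrees, at most
  k, where the maximum degree is 2k. Padding with loops and decomposing the k-regular digraph
  (Petersen) gives k classes, each with indegree = outdegree <= 1 everywhere. Class i receives the
  colours 2i+1 and 2i+2, according to the orientation, so the colours at v are the pairs of a set D
  of classes. For k <= 3 every D is a cyclic interval. For k = 4 the only exceptions are {0,2} and
  {1,3}; these are avoided by first splitting the digraph into balanced halves, one coloured with
  the classes 0, 2 and the other with the classes 1, 3.
*)

theory Submission
  imports Defs
begin

section \<open>Pairings and balanced halves\<close>

text \<open>Two elements of a common fibre are paired and removed; every fibre then loses two
  elements or none, so the parity condition survives and induction pairs the rest.\<close>

lemma fibre_pairing_exists:
  assumes "finite E" "\<And>v. even (card {e \<in> E. f e = v})"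
  shows "\<exists>\<sigma>. \<forall>e \<in> E. \<sigma> e \<in> E \<and> \<sigma> e \<noteq> e \<and> \<sigma> (\<sigma> e) = e \<and> f (\<sigma> e) = f e"
  using assms
proof (induction rule: finite_psubset_induct)
  case (psubset E)
  show ?case
  proof (cases "E = {}")
    case False
    then obtain e where e: "e \<in> E" by blast
    have fin: "finite {x \<in> E. f x = f e}" using psubset.hyps by simp
    \<comment> \<open>The fibre of \<open>e\<close> has even size, so it contains a partner for
      \<open>e\<close>.\<close>
    have "{x \<in> E. f x = f e} \<noteq> {e}"
      using psubset.prems[of "f e"] by auto
    then obtain e' where e': "e' \<in> E" "f e' = f e" "e' \<noteq> e" using e by blast
    let ?E = "E - {e, e'}"
    have "even (card {x \<in> ?E. f x = v})" for v
    proof (cases "v = f e")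
      case True
      then have "{x \<in> ?E. f x = v} = {x \<in> E. f x = v} - {e, e'}" by auto
      moreover have "card ({x \<in> E. f x = v} - {e, e'}) = card {x \<in> E. f x = v} - card {e, e'}"
        using e e' True by (intro card_Diff_subset) auto
      ultimately show ?thesis using psubset.prems[of v] e' by simp
    next
      case False
      then have "{x \<in> ?E. f x = v} = {x \<in> E. f x = v}" using e' by auto
      then show ?thesis using psubset.prems[of v] by simp
    qed
    moreover have "?E \<subset> E" using e by blast
    ultimately obtain \<sigma> where \<sigma>: "\<forall>x \<in> ?E. \<sigma> x \<in> ?E \<and> \<sigma> x \<noteq> x \<and> \<sigma> (\<sigma> x) = x \<and> f (\<sigma> x) = f x"
      using psubset.IH by blast
    show ?thesis
    proof (intro exI ballI)
      fix x assume x: "x \<in> E"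
      show "(\<sigma>(e := e', e' := e)) x \<in> E \<and> (\<sigma>(e := e', e' := e)) x \<noteq> x \<and>
        (\<sigma>(e := e', e' := e)) ((\<sigma>(e := e', e' := e)) x) = x \<and> f ((\<sigma>(e := e', e' := e)) x) = f x"
      proof (cases "x \<in> {e, e'}")
        case True then show ?thesis using e e' by auto
      next
        case False
        then have "x \<in> ?E" using x by blast
        then show ?thesis using \<sigma> by fastforce
      qed
    qed
  qed simp
qed

text \<open>
  Induction: delete a \<open>\<sigma>\<close>-pair \<open>{e, \<sigma> e}\<close> and let \<open>\<tau>\<close> pair up the former \<open>\<tau>\<close>-partners of \<open>e\<close> and \<open>\<sigma> e\<close>.
\<close>

lemma alternating_set_exists:
  assumes "finite E"
    and "\<forall>e \<in> E. \<sigma> e \<in> E \<and> \<sigma> e \<noteq> e \<and> \<sigma> (\<sigma> e) = e"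
    and "\<forall>e \<in> E. \<tau> e \<in> E \<and> \<tau> e \<noteq> e \<and> \<tau> (\<tau> e) = e"
  shows "\<exists>S \<subseteq> E. \<forall>e \<in> E. (\<sigma> e \<in> S \<longleftrightarrow> e \<notin> S) \<and> (\<tau> e \<in> S \<longleftrightarrow> e \<notin> S)"
  using assms
proof (induction arbitrary: \<tau> rule: finite_psubset_induct)
  case (psubset E)
  show ?case
  proof (cases "E = {}")
    case False
    then obtain e where e: "e \<in> E" by blast
    define e' where "e' = \<sigma> e"
    note \<sigma> = psubset.prems(1) and \<tau> = psubset.prems(2)
    have e': "e' \<in> E" "e' \<noteq> e" "\<sigma> e' = e" using \<sigma> e e'_def by auto
    let ?E = "E - {e, e'}"
    have sub: "?E \<subset> E" using e by blast
    have \<sigma>E: "\<forall>x \<in> ?E. \<sigma> x \<in> ?E \<and> \<sigma> x \<noteq> x \<and> \<sigma> (\<sigma> x) = x"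
    proof
      fix x assume x: "x \<in> ?E"
      then have "\<sigma> x \<in> E" "\<sigma> x \<noteq> x" "\<sigma> (\<sigma> x) = x" using \<sigma> by auto
      moreover from this have "\<sigma> x \<notin> {e, e'}" using e'(3) e'_def x by auto
      ultimately show "\<sigma> x \<in> ?E \<and> \<sigma> x \<noteq> x \<and> \<sigma> (\<sigma> x) = x" by simp
    qed
    show ?thesis
    proof (cases "\<tau> e = e'")
      case True
      then have "\<tau> e' = e" using \<tau> e by auto
      have \<tau>E: "\<forall>x \<in> ?E. \<tau> x \<in> ?E \<and> \<tau> x \<noteq> x \<and> \<tau> (\<tau> x) = x"
      proof
        fix x assume x: "x \<in> ?E"
        then have "\<tau> x \<in> E" "\<tau> x \<noteq> x" "\<tau> (\<tau> x) = x" using \<tau> by auto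
        moreover from this have "\<tau> x \<notin> {e, e'}" using True \<open>\<tau> e' = e\<close> x by auto
        ultimately show "\<tau> x \<in> ?E \<and> \<tau> x \<noteq> x \<and> \<tau> (\<tau> x) = x" by simp
      qed
      obtain S where S: "S \<subseteq> ?E"
        "\<forall>x \<in> ?E. (\<sigma> x \<in> S \<longleftrightarrow> x \<notin> S) \<and> (\<tau> x \<in> S \<longleftrightarrow> x \<notin> S)"
        using psubset.IH[OF sub \<sigma>E \<tau>E] by blast
      \<comment> \<open>Here \<open>{e, e'}\<close> is a pair for both involutions and does not
        interact with the rest, so choosing \<open>e\<close> is as good as choosing
        \<open>e'\<close>.\<close>
      have "\<forall>x \<in> E. (\<sigma> x \<in> insert e S \<longleftrightarrow> x \<notin> insert e S) \<and> (\<tau> x \<in> insert e S \<longleftrightarrow> x \<notin> insert e S)"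
      proof
        fix x assume x: "x \<in> E"
        show "(\<sigma> x \<in> insert e S \<longleftrightarrow> x \<notin> insert e S) \<and> (\<tau> x \<in> insert e S \<longleftrightarrow> x \<notin> insert e S)"
        proof (cases "x \<in> ?E")
          case True
          then show ?thesis using S(2) \<sigma>E \<tau>E by auto
        next
          case False
          then have "x = e \<or> x = e'" using x by blast
          then show ?thesis using S(1) e' e'_def True \<open>\<tau> e' = e\<close> by auto
        qed
      qed
      then show ?thesis using S(1) e by (intro exI[of _ "insert e S"]) auto
    next
      case False
      define a where "a = \<tau> e"
      define b where "b = \<tau> e'"
      have a: "a \<in> ?E" "\<tau> a = e" using \<tau> e e' False a_def by auto
      have b: "b \<in> ?E" "\<tau> b = e'" using \<tau> e e' False b_def by force+
      have ab: "a \<noteq> b" using a b e' by auto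
      let ?t = "\<tau>(a := b, b := a)"
      have tE: "\<forall>x \<in> ?E. ?t x \<in> ?E \<and> ?t x \<noteq> x \<and> ?t (?t x) = x"
      proof
        fix x assume x: "x \<in> ?E"
        show "?t x \<in> ?E \<and> ?t x \<noteq> x \<and> ?t (?t x) = x"
        proof (cases "x = a \<or> x = b")
          case True then show ?thesis using a b ab by auto
        next
          case False
          have "\<tau> x \<in> E" "\<tau> x \<noteq> x" "\<tau> (\<tau> x) = x" using x \<tau> by auto
          moreover have "\<tau> x \<notin> {e, e', a, b}"
            using False a b a_def b_def x \<open>\<tau> (\<tau> x) = x\<close> by auto
          ultimately show ?thesis using False by auto
        qed
      qed
      obtain S where S: "S \<subseteq> ?E"
        "\<forall>x \<in> ?E. (\<sigma> x \<in> S \<longleftrightarrow> x \<notin> S) \<and> (?t x \<in> S \<longleftrightarrow> x \<notin> S)"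
        using psubset.IH[OF sub \<sigma>E tE] by blast
      have abS: "b \<in> S \<longleftrightarrow> a \<notin> S" using S(2) a(1) ab by force
      \<comment> \<open>The modified involution pairs \<open>a\<close> with \<open>b\<close>, so
        exactly one of them is in \<open>S\<close>. The element added is the one that puts
        \<open>e\<close> opposite to \<open>a\<close> and \<open>e'\<close> opposite to
        \<open>b\<close>; \<open>e\<close> and \<open>e'\<close> are then opposite too.\<close>
      define T where "T = insert (if a \<in> S then e' else e) S"
      have T: "x \<in> T \<longleftrightarrow> x \<in> S" if "x \<in> ?E" for x using that by (auto simp: T_def)
      have Te: "e \<in> T \<longleftrightarrow> a \<notin> S" "e' \<in> T \<longleftrightarrow> a \<in> S" using S(1) e' by (auto simp: T_def)
      have \<sigma>T: "\<sigma> x \<in> T \<longleftrightarrow> x \<notin> T" if "x \<in> ?E" for x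
        using S(2) \<sigma>E T[OF that] T[of "\<sigma> x"] that by blast
      have "\<forall>x \<in> E. (\<sigma> x \<in> T \<longleftrightarrow> x \<notin> T) \<and> (\<tau> x \<in> T \<longleftrightarrow> x \<notin> T)"
      proof
        fix x assume x: "x \<in> E"
        consider "x = e" | "x = e'" | "x = a" | "x = b" | "x \<in> ?E" "x \<noteq> a" "x \<noteq> b"
          using x by blast
        then show "(\<sigma> x \<in> T \<longleftrightarrow> x \<notin> T) \<and> (\<tau> x \<in> T \<longleftrightarrow> x \<notin> T)"
        proof cases
          case 1 then show ?thesis using Te T[OF a(1)] a_def e'_def by auto
        next
          case 2 then show ?thesis using Te T[OF b(1)] b_def e' abS by auto
        next
          case 3
          then show ?thesis using Te T[OF a(1)] a(2) \<sigma>T[OF a(1)] by simp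
        next
          case 4
          then show ?thesis using Te T[OF b(1)] b(2) \<sigma>T[OF b(1)] abS by simp
        next
          case 5
          then have "?t x = \<tau> x" by simp
          moreover have "?t x \<in> ?E" "?t x \<in> S \<longleftrightarrow> x \<notin> S" using tE S(2) 5(1) by blast+
          ultimately show ?thesis using \<sigma>T[OF 5(1)] T[OF 5(1)] T[of "\<tau> x"] by simp
        qed
      qed
      moreover have "T \<subseteq> E" using S(1) e e' by (auto simp: T_def)
      ultimately show ?thesis by blast
    qed
  qed simp
qed

lemma card_fibre_split:
  assumes "finite E" "S \<subseteq> E"
  shows "card {e \<in> E. f e = v} = card {e \<in> S. f e = v} + card {e \<in> E - S. f e = v}"
proof -
  have "{e \<in> E. f e = v} = {e \<in> S. f e = v} \<union> {e \<in> E - S. f e = v}" using assms(2) by auto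
  moreover have "finite S" using assms finite_subset by blast
  ultimately show ?thesis using assms by (simp add: card_Un_disjoint disjoint_iff)
qed

text \<open>The pairing preserves fibres and exchanges \<open>S\<close> with its complement, so it
  is a bijection between the two parts of each fibre.\<close>

lemma card_alternating_fibre:
  assumes "finite E" "S \<subseteq> E"
    and \<sigma>: "\<forall>e \<in> E. \<sigma> e \<in> E \<and> \<sigma> e \<noteq> e \<and> \<sigma> (\<sigma> e) = e \<and> f (\<sigma> e) = f e"
    and S: "\<forall>e \<in> E. \<sigma> e \<in> S \<longleftrightarrow> e \<notin> S"
  shows "2 * card {e \<in> S. f e = v} = card {e \<in> E. f e = v}"
proof -
  have "bij_betw \<sigma> {e \<in> S. f e = v} {e \<in> E - S. f e = v}"
    by (rule bij_betw_byWitness[where f' = \<sigma>]) (use assms in auto)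
  then have "card {e \<in> S. f e = v} = card {e \<in> E - S. f e = v}" by (rule bij_betw_same_card)
  then show ?thesis using card_fibre_split[OF assms(1,2), of f v] by simp
qed

text \<open>The pairings along \<open>f\<close> and \<open>g\<close> are two perfect matchings on
  \<open>E\<close>, and together they form even cycles. A set alternating along these takes one
  element of each pair, hence half of each fibre. The maps serve as the two end maps of a bipartite
  graph, or as tail and head of a digraph.\<close>

lemma balanced_split:
  assumes "finite E"
    and "\<And>v. even (card {e \<in> E. f e = v})" "\<And>v. even (card {e \<in> E. g e = v})"
  shows "\<exists>S \<subseteq> E. \<forall>v w. 2 * card {e \<in> S. f e = v} = card {e \<in> E. f e = v} \<and>
    2 * card {e \<in> S. g e = w} = card {e \<in> E. g e = w}"
proof -
  obtain \<sigma> where \<sigma>: "\<forall>e \<in> E. \<sigma> e \<in> E \<and> \<sigma> e \<noteq> e \<and> \<sigma> (\<sigma> e) = e \<and> f (\<sigma> e) = f e"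
    using fibre_pairing_exists[OF assms(1,2)] by blast
  obtain \<tau> where \<tau>: "\<forall>e \<in> E. \<tau> e \<in> E \<and> \<tau> e \<noteq> e \<and> \<tau> (\<tau> e) = e \<and> g (\<tau> e) = g e"
    using fibre_pairing_exists[OF assms(1,3)] by blast
  have "\<exists>S \<subseteq> E. \<forall>e \<in> E. (\<sigma> e \<in> S \<longleftrightarrow> e \<notin> S) \<and> (\<tau> e \<in> S \<longleftrightarrow> e \<notin> S)"
    by (rule alternating_set_exists[OF assms(1)]) (use \<sigma> \<tau> in simp_all)
  then obtain S where S: "S \<subseteq> E" "\<forall>e \<in> E. (\<sigma> e \<in> S \<longleftrightarrow> e \<notin> S) \<and> (\<tau> e \<in> S \<longleftrightarrow> e \<notin> S)"
    by blast
  have "2 * card {e \<in> S. f e = v} = card {e \<in> E. f e = v}" for v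
    by (rule card_alternating_fibre[OF assms(1) S(1) \<sigma>]) (use S(2) in simp)
  moreover have "2 * card {e \<in> S. g e = v} = card {e \<in> E. g e = v}" for v
    by (rule card_alternating_fibre[OF assms(1) S(1) \<tau>]) (use S(2) in simp)
  ultimately show ?thesis using S(1) by blast
qed

section \<open>Perfect matchings in regular digraphs\<close>

text \<open>Halve repeatedly, keeping the half that contains fewer edges of \<open>B\<close>.\<close>

lemma matching_avoiding_few_edges:
  assumes "finite E" "B \<subseteq> E" "card B < 2 ^ n"
    and "\<And>e. e \<in> E \<Longrightarrow> t e \<in> V \<and> h e \<in> V"
    and "\<And>v. v \<in> V \<Longrightarrow> card {e \<in> E. t e = v} = 2 ^ n"
    and "\<And>v. v \<in> V \<Longrightarrow> card {e \<in> E. h e = v} = 2 ^ n"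
  shows "\<exists>M \<subseteq> E - B. \<forall>v \<in> V. card {e \<in> M. t e = v} = 1 \<and> card {e \<in> M. h e = v} = 1"
  using assms
proof (induction n arbitrary: E B)
  case 0
  \<comment> \<open>Now \<open>card B < 1\<close>, and all degrees are one, so \<open>E\<close>
    itself is the matching.\<close>
  then have "B = {}" using finite_subset by fastforce
  then show ?case using 0 by auto
next
  case (Suc n)
  \<comment> \<open>\<open>balanced_split\<close> asks for even fibres over every value; those
    outside \<open>V\<close> are empty.\<close>
  have out: "even (card {e \<in> E. t e = v})" for v
  proof (cases "v \<in> V")
    case False
    then have "{e \<in> E. t e = v} = {}" using Suc.prems(4) by blast
    then show ?thesis by (simp only: card.empty even_zero)
  qed (simp add: Suc.prems)
  have inn: "even (card {e \<in> E. h e = v})" for v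
  proof (cases "v \<in> V")
    case False
    then have "{e \<in> E. h e = v} = {}" using Suc.prems(4) by blast
    then show ?thesis by (simp only: card.empty even_zero)
  qed (simp add: Suc.prems)
  obtain S where S: "S \<subseteq> E"
    "\<And>v. 2 * card {e \<in> S. t e = v} = card {e \<in> E. t e = v}"
    "\<And>v. 2 * card {e \<in> S. h e = v} = card {e \<in> E. h e = v}"
    using balanced_split[OF Suc.prems(1) out inn] by blast
  have half: "card {e \<in> S. t e = v} = 2 ^ n \<and> card {e \<in> S. h e = v} = 2 ^ n \<and>
      card {e \<in> E - S. t e = v} = 2 ^ n \<and> card {e \<in> E - S. h e = v} = 2 ^ n" if "v \<in> V" for v
    using S(2,3)[of v] Suc.prems(5,6)[OF that] card_fibre_split[OF Suc.prems(1) S(1), of t v]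
      card_fibre_split[OF Suc.prems(1) S(1), of h v] by simp
  have "finite B" using Suc.prems finite_subset by blast
  then have "card B = card (B \<inter> S) + card (B - S)"
    by (metis card_Int_Diff)
  then have "card (B \<inter> S) < 2 ^ n \<or> card (B - S) < 2 ^ n" using Suc.prems(3) by auto
  then show ?case
  proof
    assume few: "card (B \<inter> S) < 2 ^ n"
    have "\<exists>M \<subseteq> S - B \<inter> S. \<forall>v \<in> V. card {e \<in> M. t e = v} = 1 \<and> card {e \<in> M. h e = v} = 1"
    proof (rule Suc.IH[OF _ _ few])
      show "finite S" using S(1) Suc.prems(1) by (rule finite_subset)
      show "t e \<in> V \<and> h e \<in> V" if "e \<in> S" for e using that S(1) Suc.prems(4) by blast
    qed (simp_all add: half)
    then show ?thesis using S(1) by blast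
  next
    assume few: "card (B - S) < 2 ^ n"
    have "\<exists>M \<subseteq> (E - S) - (B - S). \<forall>v \<in> V. card {e \<in> M. t e = v} = 1 \<and> card {e \<in> M. h e = v} = 1"
    proof (rule Suc.IH[OF _ _ few])
      show "t e \<in> V \<and> h e \<in> V" if "e \<in> E - S" for e using that Suc.prems(4) by blast
      show "finite (E - S)" using Suc.prems(1) by simp
      show "B - S \<subseteq> E - S" using Suc.prems(2) by blast
    qed (use half in \<open>simp_all only: simp_thms\<close>)
    then show ?thesis by blast
  qed
qed

text \<open>Disjoint sums model the addition of loops: \<open>Inl\<close> marks edges,
  \<open>Inr\<close> marks loops, and the same map on the right summand serves as tail and head of a
  loop.\<close>

lemma fibre_Plus:
  "{x \<in> A <+> B. case_sum f g x = v} = Inl ` {x \<in> A. f x = v} \<union> Inr ` {x \<in> B. g x = v}"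
  by auto

lemma card_fibre_Plus:
  assumes "finite A" "finite B"
  shows "card {x \<in> A <+> B. case_sum f g x = v} = card {x \<in> A. f x = v} + card {x \<in> B. g x = v}"
  unfolding fibre_Plus by (subst card_Un_disjoint) (auto simp: card_image assms)

text \<open>
  Alon's trick: \<open>2 ^ n div k\<close> copies of each edge, plus \<open>2 ^ n mod k\<close> loops at each vertex which the
  matching has to avoid, form a \<open>2 ^ n\<close>-regular digraph.
\<close>

lemma regular_perfect_matching:
  assumes "finite V" "finite E" "k > 0"
    and inV: "\<And>e. e \<in> E \<Longrightarrow> t e \<in> V \<and> h e \<in> V"
    and out: "\<And>v. v \<in> V \<Longrightarrow> card {e \<in> E. t e = v} = k"
    and inn: "\<And>v. v \<in> V \<Longrightarrow> card {e \<in> E. h e = v} = k"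
  shows "\<exists>M \<subseteq> E. \<forall>v \<in> V. card {e \<in> M. t e = v} = 1 \<and> card {e \<in> M. h e = v} = 1"
proof -
  \<comment> \<open>The exponent is large enough for the loops to be few: there are
    \<open>card V * b\<close> of them, with \<open>b < k\<close>, hence at most \<open>n\<close>,
    and \<open>n < 2 ^ n\<close>.\<close>
  define n where "n = card V * k"
  define a where "a = 2 ^ n div k"
  define b where "b = 2 ^ n mod k"
  define A where "A = E \<times> {..<a}"
  define B where "B = V \<times> {..<b}"
  have fin: "finite A" "finite B" using assms by (auto simp: A_def B_def)
  have "card B \<le> n" using \<open>k > 0\<close> by (simp add: B_def b_def n_def card_cartesian_product)
  also have "n < 2 ^ n" by (rule less_exp)
  finally have B: "card (Inr ` B) < 2 ^ n" by (simp add: card_image)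
  have deg: "card {x \<in> A <+> B. case_sum (f \<circ> fst) fst x = v} = 2 ^ n"
    if "v \<in> V" "card {e \<in> E. f e = v} = k" for f v
  proof -
    have "{x \<in> A. (f \<circ> fst) x = v} = {e \<in> E. f e = v} \<times> {..<a}" by (auto simp: A_def)
    moreover have "{x \<in> B. fst x = v} = {v} \<times> {..<b}" using that by (auto simp: B_def)
    ultimately have "card {x \<in> A <+> B. case_sum (f \<circ> fst) fst x = v} = k * a + b"
      using that(2) by (simp add: card_fibre_Plus[OF fin] card_cartesian_product)
    then show ?thesis by (simp add: a_def b_def)
  qed
  have "\<exists>M \<subseteq> (A <+> B) - Inr ` B. \<forall>v \<in> V.
      card {x \<in> M. case_sum (t \<circ> fst) fst x = v} = 1 \<and> card {x \<in> M. case_sum (h \<circ> fst) fst x = v} = 1"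
  proof (rule matching_avoiding_few_edges[OF _ _ B])
    show "finite (A <+> B)" using fin by simp
    show "Inr ` B \<subseteq> A <+> B" by auto
    show "case_sum (t \<circ> fst) fst x \<in> V \<and> case_sum (h \<circ> fst) fst x \<in> V" if "x \<in> A <+> B" for x
      using that inV by (auto simp: A_def B_def)
  qed (use deg out inn in blast)+
  then obtain M where M: "M \<subseteq> (A <+> B) - Inr ` B"
    "\<And>v. v \<in> V \<Longrightarrow> card {x \<in> M. case_sum (t \<circ> fst) fst x = v} = 1"
    "\<And>v. v \<in> V \<Longrightarrow> card {x \<in> M. case_sum (h \<circ> fst) fst x = v} = 1" by blast
  have MA: "M \<subseteq> Inl ` A" using M(1) by auto
  let ?p = "fst \<circ> projl"
  \<comment> \<open>Forgetting the index of a copy may merge elements in general, but a fibre of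
    \<open>M\<close> with one element keeps exactly one element.\<close>
  have one: "card {e \<in> ?p ` M. f e = v} = 1"
    if "card {x \<in> M. case_sum (f \<circ> fst) fst x = v} = 1" for f :: "'b \<Rightarrow> 'a" and v
  proof -
    have "{e \<in> ?p ` M. f e = v} = ?p ` {x \<in> M. case_sum (f \<circ> fst) fst x = v}"
      using MA by force
    moreover from that obtain x where "{x \<in> M. case_sum (f \<circ> fst) fst x = v} = {x}"
      by (rule card_1_singletonE)
    ultimately show ?thesis by simp
  qed
  show ?thesis
  proof (intro exI[of _ "?p ` M"] conjI ballI)
    show "?p ` M \<subseteq> E" using MA by (auto simp: A_def)
    show "card {e \<in> ?p ` M. t e = v} = 1" "card {e \<in> ?p ` M. h e = v} = 1" if "v \<in> V" for v
      using one M(2,3) that by simp_all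
  qed
qed

section \<open>Class colourings of balanced digraphs\<close>

text \<open>Petersen's argument: a perfect matching is split off and receives the last colour
  \<open>k\<close>, and what remains is \<open>k\<close>-regular and is coloured by
  induction.\<close>

lemma regular_coloring:
  assumes "finite V" "finite E"
    and "\<And>e. e \<in> E \<Longrightarrow> t e \<in> V \<and> h e \<in> V"
    and "\<And>v. v \<in> V \<Longrightarrow> card {e \<in> E. t e = v} = k"
    and "\<And>v. v \<in> V \<Longrightarrow> card {e \<in> E. h e = v} = k"
  shows "\<exists>c. \<forall>v \<in> V. bij_betw c {e \<in> E. t e = v} {..<k} \<and> bij_betw c {e \<in> E. h e = v} {..<k}"
  using assms
proof (induction k arbitrary: E)
  case 0
  then have "{e \<in> E. t e = v} = {} \<and> {e \<in> E. h e = v} = {}" if "v \<in> V" for v using that by auto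
  then have "\<forall>v \<in> V. bij_betw (\<lambda>_. 0) {e \<in> E. t e = v} {..<0 :: nat} \<and>
      bij_betw (\<lambda>_. 0) {e \<in> E. h e = v} {..<0 :: nat}"
    by (simp add: bij_betw_def del: Collect_empty_eq)
  then show ?case by blast
next
  case (Suc k)
  obtain M where M: "M \<subseteq> E"
    "\<And>v. v \<in> V \<Longrightarrow> card {e \<in> M. t e = v} = 1" "\<And>v. v \<in> V \<Longrightarrow> card {e \<in> M. h e = v} = 1"
    using regular_perfect_matching[OF Suc.prems(1,2) _ Suc.prems(3-5)] by blast
  have "\<exists>c. \<forall>v \<in> V. bij_betw c {e \<in> E - M. t e = v} {..<k} \<and> bij_betw c {e \<in> E - M. h e = v} {..<k}"
  proof (rule Suc.IH)
    show "card {e \<in> E - M. t e = v} = k" "card {e \<in> E - M. h e = v} = k" if "v \<in> V" for v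
      using card_fibre_split[OF Suc.prems(2) M(1), of t v] card_fibre_split[OF Suc.prems(2) M(1), of h v]
        M(2,3)[OF that] Suc.prems(4,5)[OF that] by simp_all
  qed (use Suc.prems in auto)
  then obtain c where c: "\<And>v. v \<in> V \<Longrightarrow> bij_betw c {e \<in> E - M. t e = v} {..<k}"
    "\<And>v. v \<in> V \<Longrightarrow> bij_betw c {e \<in> E - M. h e = v} {..<k}" by blast
  define d where "d e = (if e \<in> M then k else c e)" for e
  have "bij_betw d {e \<in> E. f e = v} {..<Suc k}"
    if "card {e \<in> M. f e = v} = 1" "bij_betw c {e \<in> E - M. f e = v} {..<k}" for f :: "'b \<Rightarrow> 'a" and v
  proof -
    from that(1) obtain m where m: "{e \<in> M. f e = v} = {m}" by (rule card_1_singletonE)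
    then have "m \<in> M" by blast
    then have "d m = k" by (simp add: d_def)
    have "bij_betw d {e \<in> E - M. f e = v} {..<k}"
      using that(2) by (rule bij_betw_cong[THEN iffD1, rotated]) (simp add: d_def)
    then have "bij_betw d ({e \<in> E - M. f e = v} \<union> {m}) ({..<k} \<union> {d m})"
      using \<open>m \<in> M\<close> \<open>d m = k\<close> by (intro notIn_Un_bij_betw) auto
    moreover have "{e \<in> E. f e = v} = {e \<in> E - M. f e = v} \<union> {m}" using m M(1) by blast
    moreover have "{..<Suc k} = {..<k} \<union> {d m}" using \<open>d m = k\<close> by auto
    ultimately show ?thesis by simp
  qed
  then show ?case using M(2,3) c by blast
qed

text \<open>Adding \<open>k\<close> minus the outdegree many loops at each vertex gives a
  \<open>k\<close>-regular digraph, because in- and outdegree agree. In its colouring all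
  \<open>k\<close> colours leave and enter each vertex, and the loops use up the same colours on
  both sides.\<close>

lemma balanced_digraph_coloring:
  assumes "finite V" "finite E"
    and inV: "\<And>e. e \<in> E \<Longrightarrow> t e \<in> V \<and> h e \<in> V"
    and bal: "\<And>v. v \<in> V \<Longrightarrow> card {e \<in> E. h e = v} = card {e \<in> E. t e = v}"
    and le: "\<And>v. v \<in> V \<Longrightarrow> card {e \<in> E. t e = v} \<le> k"
  shows "\<exists>c. (\<forall>e \<in> E. c e < k) \<and> (\<forall>v \<in> V. inj_on c {e \<in> E. t e = v} \<and> inj_on c {e \<in> E. h e = v} \<and>
    c ` {e \<in> E. t e = v} = c ` {e \<in> E. h e = v})"
proof -
  define L where "L = Sigma V (\<lambda>v. {..<k - card {e \<in> E. t e = v}})"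
  have finL: "finite L" using assms(1) by (simp add: L_def)
  have loops: "{x \<in> L. fst x = v} = {v} \<times> {..<k - card {e \<in> E. t e = v}}" if "v \<in> V" for v
    using that by (auto simp: L_def)
  have "\<exists>c. \<forall>v \<in> V. bij_betw c {x \<in> E <+> L. case_sum t fst x = v} {..<k} \<and>
      bij_betw c {x \<in> E <+> L. case_sum h fst x = v} {..<k}"
  proof (rule regular_coloring)
    show "case_sum t fst x \<in> V \<and> case_sum h fst x \<in> V" if "x \<in> E <+> L" for x
      using that inV by (auto simp: L_def)
    show "card {x \<in> E <+> L. case_sum t fst x = v} = k" "card {x \<in> E <+> L. case_sum h fst x = v} = k"
      if "v \<in> V" for v
      using bal[OF that] le[OF that]
      by (simp_all add: card_fibre_Plus[OF assms(2) finL] loops[OF that] card_cartesian_product)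
  qed (use assms(1,2) finL in auto)
  then obtain c where c: "\<And>v. v \<in> V \<Longrightarrow> bij_betw c {x \<in> E <+> L. case_sum t fst x = v} {..<k}"
    "\<And>v. v \<in> V \<Longrightarrow> bij_betw c {x \<in> E <+> L. case_sum h fst x = v} {..<k}" by blast
  \<comment> \<open>The colours left at \<open>v\<close> once its loops are removed. The right-hand
    side of the image equation does not mention \<open>f\<close>, which is what makes the tail and
    head colour sets equal.\<close>
  have restrict: "inj_on (c \<circ> Inl) {e \<in> E. f e = v} \<and>
      (c \<circ> Inl) ` {e \<in> E. f e = v} = {..<k} - c ` Inr ` {x \<in> L. fst x = v}"
    if "bij_betw c {x \<in> E <+> L. case_sum f fst x = v} {..<k}" for f v
  proof -
    have "inj_on c (Inl ` {e \<in> E. f e = v} \<union> Inr ` {x \<in> L. fst x = v})"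
      "c ` (Inl ` {e \<in> E. f e = v} \<union> Inr ` {x \<in> L. fst x = v}) = {..<k}"
      using that by (simp_all add: fibre_Plus bij_betw_def)
    moreover from this(1) have "c ` Inl ` {e \<in> E. f e = v} \<inter> c ` Inr ` {x \<in> L. fst x = v} = {}"
      by (subst inj_on_image_Int[symmetric]) auto
    ultimately show ?thesis
      by (auto simp: inj_on_Un image_Un image_comp intro!: comp_inj_on)
  qed
  have "(c \<circ> Inl) e < k" if "e \<in> E" for e
    using restrict[OF c(1), of "t e"] inV[OF that] that by auto
  then have "\<forall>e \<in> E. (c \<circ> Inl) e < k" by blast
  moreover have "\<forall>v \<in> V. inj_on (c \<circ> Inl) {e \<in> E. t e = v} \<and> inj_on (c \<circ> Inl) {e \<in> E. h e = v} \<and>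
      (c \<circ> Inl) ` {e \<in> E. t e = v} = (c \<circ> Inl) ` {e \<in> E. h e = v}"
    using restrict[OF c(1)] restrict[OF c(2)] by simp
  ultimately show ?thesis by blast
qed

text \<open>
  A vertex of outdegree two must have outdegree one in each half. The split becomes exact once a loop
  is added at each vertex of odd outdegree.
\<close>

lemma balanced_digraph_coloring_four:
  assumes "finite V" "finite E"
    and inV: "\<And>e. e \<in> E \<Longrightarrow> t e \<in> V \<and> h e \<in> V"
    and bal: "\<And>v. v \<in> V \<Longrightarrow> card {e \<in> E. h e = v} = card {e \<in> E. t e = v}"
    and le: "\<And>v. v \<in> V \<Longrightarrow> card {e \<in> E. t e = v} \<le> 4"
  shows "\<exists>c :: 'e \<Rightarrow> nat. (\<forall>e \<in> E. c e < 4) \<and>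
    (\<forall>v \<in> V. inj_on c {e \<in> E. t e = v} \<and> inj_on c {e \<in> E. h e = v} \<and>
      c ` {e \<in> E. t e = v} = c ` {e \<in> E. h e = v} \<and> c ` {e \<in> E. t e = v} \<notin> {{0, 2}, {1, 3}})"
proof -
  define L where "L = {v \<in> V. odd (card {e \<in> E. t e = v})}"
  have finL: "finite L" using assms(1) by (simp add: L_def)
  have loops: "card {x \<in> L. id x = v} = card {e \<in> E. t e = v} mod 2" if "v \<in> V" for v
  proof (cases "v \<in> L")
    case True
    then have "{x \<in> L. id x = v} = {v}" by auto
    then show ?thesis using True by (simp add: L_def odd_iff_mod_2_eq_one)
  next
    case False
    then have "{x \<in> L. id x = v} = {}" by auto
    then have "card {x \<in> L. id x = v} = 0" by (simp only: card.empty)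
    then show ?thesis using False that by (simp add: L_def)
  qed
  have even: "even (card {x \<in> E <+> L. case_sum f id x = v})"
    if "\<And>e. e \<in> E \<Longrightarrow> f e \<in> V" "\<And>v. v \<in> V \<Longrightarrow> card {e \<in> E. f e = v} = card {e \<in> E. t e = v}" for f v
  proof (cases "v \<in> V")
    case True
    have "even (m + m mod 2)" for m :: nat by presburger
    then show ?thesis using True by (simp only: card_fibre_Plus[OF assms(2) finL] that loops)
  next
    case False
    then have "{x \<in> E <+> L. case_sum f id x = v} = {}" using that(1) by (auto simp: L_def)
    then show ?thesis by (simp only: card.empty even_zero)
  qed
  obtain S where S: "S \<subseteq> E <+> L"
    "\<And>v. 2 * card {x \<in> S. case_sum t id x = v} = card {x \<in> E <+> L. case_sum t id x = v}"
    "\<And>v. 2 * card {x \<in> S. case_sum h id x = v} = card {x \<in> E <+> L. case_sum h id x = v}"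
    using balanced_split[OF finite_Plus[OF assms(2) finL] even[of t] even[of h]] inV bal by blast
  define E1 where "E1 = Inl -` S"
  define E2 where "E2 = E - E1"
  define L1 where "L1 = Inr -` S"
  have sub: "E1 \<subseteq> E" "L1 \<subseteq> L" using S(1) by (auto simp: E1_def L1_def)
  have inE2: "E2 \<subseteq> E" by (auto simp: E2_def)
  have fin: "finite E1" "finite E2" "finite L1"
    using sub assms(2) finL finite_subset by (auto simp: E2_def)
  have S_eq: "S = E1 <+> L1" using S(1) by (auto simp: E1_def L1_def)
  have half: "2 * (card {e \<in> E1. t e = v} + card {x \<in> L1. id x = v}) = m + m mod 2"
    "card {e \<in> E1. h e = v} = card {e \<in> E1. t e = v}"
    "card {e \<in> E2. h e = v} = card {e \<in> E2. t e = v}"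
    "card {e \<in> E1. t e = v} + card {e \<in> E2. t e = v} = m"
    "card {x \<in> L1. id x = v} \<le> m mod 2" "m \<le> 4"
    if "v \<in> V" "m = card {e \<in> E. t e = v}" for v m
  proof -
    show 1: "2 * (card {e \<in> E1. t e = v} + card {x \<in> L1. id x = v}) = m + m mod 2"
      using S(2)[of v] unfolding S_eq card_fibre_Plus[OF fin(1,3)] card_fibre_Plus[OF assms(2) finL]
      by (simp only: loops that)
    \<comment> \<open>A loop in \<open>L1\<close> counts once as tail and once as head, so it
      cancels and \<open>E1\<close> is balanced; its complement \<open>E2\<close> then is balanced
      as well.\<close>
    have "2 * (card {e \<in> E1. h e = v} + card {x \<in> L1. id x = v}) = m + m mod 2"
      using S(3)[of v] unfolding S_eq card_fibre_Plus[OF fin(1,3)] card_fibre_Plus[OF assms(2) finL]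
      by (simp only: loops that bal)
    then show 2: "card {e \<in> E1. h e = v} = card {e \<in> E1. t e = v}" using 1 by simp
    show "card {e \<in> E2. h e = v} = card {e \<in> E2. t e = v}"
      "card {e \<in> E1. t e = v} + card {e \<in> E2. t e = v} = m"
      using card_fibre_split[OF assms(2) sub(1), of t v] card_fibre_split[OF assms(2) sub(1), of h v]
        bal[OF that(1)] 2 that(2) by (simp_all add: E2_def)
    have "card {x \<in> L1. id x = v} \<le> card {x \<in> L. id x = v}"
      using sub finL by (intro card_mono) auto
    then show "card {x \<in> L1. id x = v} \<le> m mod 2" by (simp only: loops that)
    show "m \<le> 4" using le that by simp
  qed
  \<comment> \<open>For outdegree \<open>m\<close> the halves have
    \<open>(m + m mod 2) div 2 - l\<close> and \<open>m div 2 + l\<close> outgoing edges, where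
    \<open>l\<close> counts the loop in the first half and is 0 for even \<open>m\<close>. Both
    numbers are at most two since \<open>m \<le> 4\<close>.\<close>
  have le_two: "a \<le> 2 \<and> b \<le> 2"
    if "2 * (a + l) = m + m mod 2" "a + b = m" "l \<le> m mod 2" "m \<le> 4" for a b l m :: nat
  proof -
    have "m = 0 \<or> m = 1 \<or> m = 2 \<or> m = 3 \<or> m = 4" using that(4) by linarith
    then show ?thesis using that(1-3) by auto
  qed
  have le2: "card {e \<in> E1. t e = v} \<le> 2 \<and> card {e \<in> E2. t e = v} \<le> 2" if "v \<in> V" for v
    by (rule le_two[OF half(1,4,5,6)[OF that refl]])
  have "\<exists>c. (\<forall>e \<in> E1. c e < (2 :: nat)) \<and> (\<forall>v \<in> V. inj_on c {e \<in> E1. t e = v} \<and>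
      inj_on c {e \<in> E1. h e = v} \<and> c ` {e \<in> E1. t e = v} = c ` {e \<in> E1. h e = v})"
    by (rule balanced_digraph_coloring[OF assms(1) fin(1) inV[OF subsetD[OF sub(1)]] half(2)[OF _ refl]
        conjunct1[OF le2]])
  then obtain c1 where c1: "\<forall>e \<in> E1. c1 e < (2 :: nat)"
    "\<forall>v \<in> V. inj_on c1 {e \<in> E1. t e = v} \<and> inj_on c1 {e \<in> E1. h e = v} \<and>
      c1 ` {e \<in> E1. t e = v} = c1 ` {e \<in> E1. h e = v}"
    by (elim exE conjE) (rule that)
  have "\<exists>c. (\<forall>e \<in> E2. c e < (2 :: nat)) \<and> (\<forall>v \<in> V. inj_on c {e \<in> E2. t e = v} \<and>
      inj_on c {e \<in> E2. h e = v} \<and> c ` {e \<in> E2. t e = v} = c ` {e \<in> E2. h e = v})"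
    by (rule balanced_digraph_coloring[OF assms(1) fin(2) inV[OF subsetD[OF inE2]] half(3)[OF _ refl]
        conjunct2[OF le2]])
  then obtain c2 where c2: "\<forall>e \<in> E2. c2 e < (2 :: nat)"
    "\<forall>v \<in> V. inj_on c2 {e \<in> E2. t e = v} \<and> inj_on c2 {e \<in> E2. h e = v} \<and>
      c2 ` {e \<in> E2. t e = v} = c2 ` {e \<in> E2. h e = v}"
    by (elim exE conjE) (rule that)
  \<comment> \<open>The classes 0, 1 of \<open>E1\<close> become 0, 2 and those of \<open>E2\<close>
    become 1, 3, so the parity of a class tells which half an edge belongs to.\<close>
  define c where "c e = (if e \<in> E1 then 2 * c1 e else 2 * c2 e + 1)" for e
  have c_less: "c e < 4" if "e \<in> E" for e
    using that c1(1)[rule_format, of e] c2(1)[rule_format, of e] by (auto simp: c_def E2_def)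
  have inj: "inj_on c {e \<in> E. f e = v}"
    if "inj_on c1 {e \<in> E1. f e = v}" "inj_on c2 {e \<in> E2. f e = v}" for f v
  proof (rule inj_onI)
    fix x y assume xy: "x \<in> {e \<in> E. f e = v}" "y \<in> {e \<in> E. f e = v}" and eq: "c x = c y"
    have "even (c x) \<longleftrightarrow> x \<in> E1" "even (c y) \<longleftrightarrow> y \<in> E1" by (simp_all add: c_def)
    then have iff: "x \<in> E1 \<longleftrightarrow> y \<in> E1" using eq by simp
    show "x = y"
    proof (cases "x \<in> E1")
      case True
      then have "c1 x = c1 y" using eq iff by (simp add: c_def)
      then show ?thesis using inj_onD[OF that(1)] True iff xy by blast
    next
      case False
      then have "c2 x = c2 y" using eq iff by (simp add: c_def)
      then show ?thesis using inj_onD[OF that(2)] False iff xy by (simp add: E2_def)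
    qed
  qed
  have inj_t: "inj_on c {e \<in> E. t e = v}" and inj_h: "inj_on c {e \<in> E. h e = v}" if "v \<in> V" for v
    by (rule inj; use c1(2) c2(2) that in simp)+
  have img: "c ` {e \<in> E. f e = v} =
      (\<lambda>i. 2 * i) ` c1 ` {e \<in> E1. f e = v} \<union> (\<lambda>i. 2 * i + 1) ` c2 ` {e \<in> E2. f e = v}" for f v
  proof -
    have "{e \<in> E. f e = v} = {e \<in> E1. f e = v} \<union> {e \<in> E2. f e = v}" using sub by (auto simp: E2_def)
    then have "c ` {e \<in> E. f e = v} = c ` {e \<in> E1. f e = v} \<union> c ` {e \<in> E2. f e = v}"
      by (simp only: image_Un)
    moreover have "c ` {e \<in> E1. f e = v} = (\<lambda>i. 2 * i) ` c1 ` {e \<in> E1. f e = v}"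
      unfolding image_image by (rule image_cong) (auto simp: c_def)
    moreover have "c ` {e \<in> E2. f e = v} = (\<lambda>i. 2 * i + 1) ` c2 ` {e \<in> E2. f e = v}"
      unfolding image_image by (rule image_cong) (auto simp: c_def E2_def)
    ultimately show ?thesis by simp
  qed
  have not_opposite: "c ` {e \<in> E. t e = v} \<notin> {{0, 2}, {1, 3}}" if v: "v \<in> V" for v
  proof
    assume D: "c ` {e \<in> E. t e = v} \<in> {{0, 2}, {1, 3}}"
    then have "card (c ` {e \<in> E. t e = v}) = 2" by auto
    then have "card {e \<in> E. t e = v} = 2" using card_image[OF inj_t[OF v]] by simp
    note two = this
    \<comment> \<open>With outdegree two there is no loop at \<open>v\<close>, so each half has
      exactly one outgoing edge there. Both parities therefore occur in the set of classes, whereas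
      \<open>{0, 2}\<close> and \<open>{1, 3}\<close> each have only one.\<close>
    have "a = 1 \<and> b = 1" if "2 * (a + l) = 2 + 2 mod 2" "a + b = 2" "l \<le> 2 mod 2" for a b l :: nat
      using that by simp
    note this[OF half(1,4,5)[OF v two[symmetric]]]
    then have "card {e \<in> E1. t e = v} = 1" "card {e \<in> E2. t e = v} = 1" by blast+
    then obtain e1 e2 where e: "e1 \<in> E1" "t e1 = v" "e2 \<in> E2" "t e2 = v"
      by (metis (mono_tags, lifting) card_1_singletonE insertI1 mem_Collect_eq)
    have mem: "c e1 \<in> c ` {e \<in> E. t e = v}" "c e2 \<in> c ` {e \<in> E. t e = v}"
      using e sub inE2 by (auto intro!: imageI)
    have parity: "even (c e1)" "odd (c e2)" using e by (simp_all add: c_def E2_def)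
    have "a \<notin> A \<or> b \<notin> A" if "even a" "odd b" "A \<in> {{0, 2}, {1, 3}}" for a b :: nat and A
      using that by auto
    from this[OF parity D] show False using mem by simp
  qed
  have "c ` {e \<in> E. t e = v} = c ` {e \<in> E. h e = v}" if "v \<in> V" for v
    unfolding img using c1(2) c2(2) that by simp
  then show ?thesis using c_less inj_t inj_h not_opposite by (intro exI[of _ c] conjI ballI)
qed

section \<open>Cyclic intervals of classes and colours\<close>

text \<open>A finite set without gaps is the interval from its minimum to its maximum. The disjuncts
  after the first list the triples \<open>a < b < c\<close> below 4 in which \<open>b\<close> is a
  gap.\<close>

lemma interval_or_gap:
  fixes A :: "nat set"
  assumes "A \<subseteq> {..<4}"
  shows "(\<exists>i j. A = {i..<j}) \<or> 0 \<in> A \<and> 1 \<notin> A \<and> 2 \<in> A \<or> 0 \<in> A \<and> 1 \<notin> A \<and> 3 \<in> A \<or>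
    0 \<in> A \<and> 2 \<notin> A \<and> 3 \<in> A \<or> 1 \<in> A \<and> 2 \<notin> A \<and> 3 \<in> A"
proof (cases "\<exists>a b c. a < b \<and> b < c \<and> a \<in> A \<and> b \<notin> A \<and> c \<in> A")
  case True
  then obtain a b c where abc: "a < b" "b < c" "a \<in> A" "b \<notin> A" "c \<in> A" by blast
  then have "c < 4" using assms by blast
  then have "c = 2 \<or> c = 3" "b = 1 \<or> b = 2" "a = 0 \<or> a = 1" using abc(1,2) by linarith+
  then show ?thesis using abc by auto
next
  case False
  show ?thesis
  proof (cases "A = {}")
    case True
    then have "A = {0..<0}" by simp
    then show ?thesis by blast
  next
    case nonempty: False
    have fin: "finite A" using assms finite_subset by blast
    have "A = {Min A..<Suc (Max A)}"
    proof (intro equalityI subsetI)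
      fix x assume "x \<in> A"
      then show "x \<in> {Min A..<Suc (Max A)}" using fin by (simp add: le_imp_less_Suc)
    next
      fix x assume "x \<in> {Min A..<Suc (Max A)}"
      then have "Min A \<le> x" "x \<le> Max A" by auto
      moreover have "Min A \<in> A" "Max A \<in> A" using fin nonempty by auto
      ultimately show "x \<in> A" using False by (metis le_neq_implies_less)
    qed
    then show ?thesis by blast
  qed
qed

text \<open>If both \<open>D\<close> and its complement had a gap, membership would alternate along
  0, 1, 2, 3, which leaves only the two excluded sets.\<close>

lemma interval_or_co_interval:
  assumes "D \<subseteq> {..<k}" "k \<le> 4" "k = 4 \<Longrightarrow> D \<notin> {{0, 2}, {1, 3}}"
  shows "\<exists>i j. D = {i..<j} \<or> {..<k} - D = {i..<j::nat}"
proof (rule ccontr)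
  assume contra: "\<not> ?thesis"
  have "D \<subseteq> {..<4}" "{..<k} - D \<subseteq> {..<4}" using assms(1,2) by auto
  note gaps = this[THEN interval_or_gap]
  \<comment> \<open>Comparing the gap patterns of both sets leaves these two alternations. In the
    first one 3 lies in the complement, which yields \<open>3 < k\<close>; in the second
    \<open>3 \<in> D\<close> gives the same bound, so \<open>k = 4\<close> either way.\<close>
  have "0 \<in> D \<and> 1 \<notin> D \<and> 2 \<in> D \<and> 3 \<notin> D \<and> 3 < k \<or> 0 \<notin> D \<and> 1 \<in> D \<and> 2 \<notin> D \<and> 3 \<in> D"
    using gaps contra by auto
  moreover from this have "k = 4" using assms(1,2) by auto
  moreover have "x \<in> D \<Longrightarrow> x = 0 \<or> x = 1 \<or> x = 2 \<or> x = 3" for x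
    using \<open>D \<subseteq> {..<4}\<close> by force
  ultimately have "D = {0, 2} \<or> D = {1, 3}" by blast
  then show False using assms(3)[OF \<open>k = 4\<close>] by blast
qed

text \<open>Class \<open>i\<close> owns the colours \<open>2 * i + 1\<close> and
  \<open>2 * i + 2\<close>, and \<open>(m - 1) div 2\<close> recovers the class of \<open>m\<close>.
  Adjacent classes own adjacent pairs, so intervals of classes become intervals of colours, also for
  the complement. The condition \<open>0 < m\<close> matters because truncated subtraction would put
  0 into class 0.\<close>

lemma consecutive_color_pairs:
  assumes "D \<subseteq> {..<k}" "k \<le> 4" "k = 4 \<Longrightarrow> D \<notin> {{0, 2}, {1, 3}}"
  defines "S \<equiv> {m. 0 < m \<and> (m - 1) div 2 \<in> D}"
  shows "consecutive S \<or> consecutive ({1..2 * k} - S)"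
proof -
  have pairs: "{m. 0 < m \<and> (m - 1) div 2 \<in> {i..<j}} = {2 * i + 1..2 * j}" for i j :: nat
    by (auto simp: less_eq_div_iff_mult_less_eq div_less_iff_less_mult)
  obtain i j where "D = {i..<j} \<or> {..<k} - D = {i..<j}"
    using interval_or_co_interval[OF assms(1-3)] by blast
  then show ?thesis
  proof
    assume "D = {i..<j}"
    then have "S = {2 * i + 1..2 * j}" using pairs by (simp add: S_def)
    then show ?thesis unfolding consecutive_def by blast
  next
    assume eq: "{..<k} - D = {i..<j}"
    have "{1..2 * k} - S = {m. 0 < m \<and> (m - 1) div 2 \<in> {..<k} - D}" by (auto simp: S_def)
    then have "{1..2 * k} - S = {2 * i + 1..2 * j}" using pairs eq by simp
    then show ?thesis unfolding consecutive_def by blast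
  qed
qed

section \<open>Orientation and colouring of the bipartite graph\<close>

theorem theorem3:
  fixes G :: "('v, 'e) pre_multigraph"
  assumes "finite_multigraph G"
    and "eulerian G"
    and "bipartite G"
    and "max_degree G \<le> 8"
  shows "\<exists>\<alpha>. cyclic_interval_coloring G (max_degree G) \<alpha>"
proof -
  interpret finite_multigraph G by fact
  have deg_le: "degree G v \<le> max_degree G" if "v \<in> verts G" for v
    unfolding max_degree_def using finite_verts that by (intro Max_ge) auto
  \<comment> \<open>The maximum is 0 or the degree of some vertex, hence even.\<close>
  have "max_degree G \<in> insert 0 (degree G ` verts G)"
    unfolding max_degree_def using finite_verts by (intro Max_in) auto
  then have "even (max_degree G)" using assms(2) unfolding eulerian_def by auto
  then obtain k where k: "max_degree G = 2 * k" by blast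
  have "k \<le> 4" using assms(4) k by simp
  obtain X Y where XY: "X \<union> Y = verts G" "X \<inter> Y = {}"
    "\<forall>e \<in> edges G. \<exists>x \<in> X. \<exists>y \<in> Y. ends G e = {x, y}" using assms(3) unfolding bipartite_def by blast
  have "\<forall>e \<in> edges G. \<exists>p. fst p \<in> X \<and> snd p \<in> Y \<and> ends G e = {fst p, snd p}"
    using XY(3) by (metis fst_conv snd_conv)
  then have "\<exists>p. \<forall>e \<in> edges G. fst (p e) \<in> X \<and> snd (p e) \<in> Y \<and> ends G e = {fst (p e), snd (p e)}"
    by (rule bchoice)
  then obtain p where p: "\<forall>e \<in> edges G. fst (p e) \<in> X \<and> snd (p e) \<in> Y \<and> ends G e = {fst (p e), snd (p e)}"
    by blast
  define x where "x e = fst (p e)" for e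
  define y where "y e = snd (p e)" for e
  have xy: "x e \<in> X \<and> y e \<in> Y \<and> ends G e = {x e, y e}" if "e \<in> edges G" for e
    using p that by (simp add: x_def y_def)
  have x_iff: "x e = v \<longleftrightarrow> v \<in> ends G e" if "v \<in> X" "e \<in> edges G" for v e
    using xy[OF that(2)] that(1) XY(2) by auto
  \<comment> \<open>Over a vertex of its own side, the fibre of an end map is the set of incident
    edges; elsewhere it is empty. Even degrees thus give the even fibres needed for
    splitting.\<close>
  have fibX: "{e \<in> A. x e = v} = incident_edges G v \<inter> A" if "v \<in> X" "A \<subseteq> edges G" for v A
    using that x_iff by (auto simp: incident_edges_def)
  have y_iff: "y e = v \<longleftrightarrow> v \<in> ends G e" if "v \<in> Y" "e \<in> edges G" for v e
    using xy[OF that(2)] that(1) XY(2) by auto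
  have fibY: "{e \<in> A. y e = v} = incident_edges G v \<inter> A" if "v \<in> Y" "A \<subseteq> edges G" for v A
    using that y_iff by (auto simp: incident_edges_def)
  have inc: "incident_edges G v \<subseteq> edges G" for v by (auto simp: incident_edges_def)
  have even_x: "even (card {e \<in> edges G. x e = v})" for v
  proof (cases "v \<in> X")
    case True
    then show ?thesis
      using fibX[of v "edges G"] inc[of v] assms(2) XY(1) by (auto simp: eulerian_def degree_def Int_absorb2)
  next
    case False
    then have "{e \<in> edges G. x e = v} = {}" using xy by blast
    then show ?thesis by (simp only: card.empty even_zero)
  qed
  have even_y: "even (card {e \<in> edges G. y e = v})" for v
  proof (cases "v \<in> Y")
    case True
    then show ?thesis
      using fibY[of v "edges G"] inc[of v] assms(2) XY(1) by (auto simp: eulerian_def degree_def Int_absorb2)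
  next
    case False
    then have "{e \<in> edges G. y e = v} = {}" using xy by blast
    then show ?thesis by (simp only: card.empty even_zero)
  qed
  obtain S where S: "S \<subseteq> edges G"
    "\<And>v. 2 * card {e \<in> S. x e = v} = card {e \<in> edges G. x e = v}"
    "\<And>v. 2 * card {e \<in> S. y e = v} = card {e \<in> edges G. y e = v}"
    using balanced_split[OF finite_edges even_x even_y] by blast
  have inc_S: "2 * card (incident_edges G v \<inter> S) = degree G v" if "v \<in> verts G" for v
  proof (cases "v \<in> X")
    case True
    then show ?thesis
      using S(2)[of v] unfolding fibX[OF True S(1)] fibX[OF True order_refl] degree_def
      by (simp only: Int_absorb2[OF inc])
  next
    case False
    then have Y: "v \<in> Y" using that XY(1) by blast
    then show ?thesis
      using S(3)[of v] unfolding fibY[OF Y S(1)] fibY[OF Y order_refl] degree_def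
      by (simp only: Int_absorb2[OF inc])
  qed
  have inc_S': "card (incident_edges G v - S) = card (incident_edges G v \<inter> S)" if "v \<in> verts G" for v
    using inc_S[OF that] card_Int_Diff[OF finite_subset[OF inc finite_edges], of v S]
    unfolding degree_def by linarith
  define t where "t e = (if e \<in> S then x e else y e)" for e
  define h where "h e = (if e \<in> S then y e else x e)" for e
  have in_verts: "t e \<in> verts G \<and> h e \<in> verts G" if "e \<in> edges G" for e
    using xy[OF that] XY(1) by (auto simp: t_def h_def)
  \<comment> \<open>At a vertex of \<open>X\<close> the edges in \<open>S\<close> leave and the
    others enter; at a vertex of \<open>Y\<close> it is the reverse. Later steps use only that
    \<open>S\<close> separates the two directions at each vertex.\<close>
  have fib: "{e \<in> edges G. t e = v} = incident_edges G v \<inter> S \<and>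
      {e \<in> edges G. h e = v} = incident_edges G v - S \<or>
      {e \<in> edges G. t e = v} = incident_edges G v - S \<and>
      {e \<in> edges G. h e = v} = incident_edges G v \<inter> S" if "v \<in> verts G" for v
  proof (cases "v \<in> X")
    case True
    have "t e = v \<longleftrightarrow> v \<in> ends G e \<and> e \<in> S" "h e = v \<longleftrightarrow> v \<in> ends G e \<and> e \<notin> S" if "e \<in> edges G" for e
      using xy[OF that] True XY(2) by (auto simp: t_def h_def)
    then show ?thesis unfolding incident_edges_def by blast
  next
    case False
    then have "v \<in> Y" using that XY(1) by blast
    then have "t e = v \<longleftrightarrow> v \<in> ends G e \<and> e \<notin> S" "h e = v \<longleftrightarrow> v \<in> ends G e \<and> e \<in> S" if "e \<in> edges G" for e
      using xy[OF that] XY(2) by (auto simp: t_def h_def)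
    then show ?thesis unfolding incident_edges_def by blast
  qed
  have bal: "card {e \<in> edges G. h e = v} = card {e \<in> edges G. t e = v}"
    and le_k: "card {e \<in> edges G. t e = v} \<le> k" if "v \<in> verts G" for v
    using fib[OF that] inc_S'[OF that] inc_S[OF that] deg_le[OF that] k by auto
  have "\<exists>c. (\<forall>e \<in> edges G. c e < k) \<and> (\<forall>v \<in> verts G.
      inj_on c {e \<in> edges G. t e = v} \<and> inj_on c {e \<in> edges G. h e = v} \<and>
      c ` {e \<in> edges G. t e = v} = c ` {e \<in> edges G. h e = v} \<and>
      (k = 4 \<longrightarrow> c ` {e \<in> edges G. t e = v} \<notin> {{0, 2}, {1, 3}}))"
  proof (cases "k = 4")
    case True
    then show ?thesis
      using balanced_digraph_coloring_four[OF finite_verts finite_edges in_verts bal] le_k by simp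
  next
    case False
    then show ?thesis
      using balanced_digraph_coloring[OF finite_verts finite_edges in_verts bal le_k] by simp
  qed
  then obtain c where c: "\<forall>e \<in> edges G. c e < k" "\<forall>v \<in> verts G.
      inj_on c {e \<in> edges G. t e = v} \<and> inj_on c {e \<in> edges G. h e = v} \<and>
      c ` {e \<in> edges G. t e = v} = c ` {e \<in> edges G. h e = v} \<and>
      (k = 4 \<longrightarrow> c ` {e \<in> edges G. t e = v} \<notin> {{0, 2}, {1, 3}})"
    by (elim exE conjE) (rule that)
  have c_less: "c e < k" if "e \<in> edges G" for e using c(1) that by (rule bspec)
  have c_inj: "inj_on c {e \<in> edges G. t e = v} \<and> inj_on c {e \<in> edges G. h e = v}"
    and c_img: "c ` {e \<in> edges G. t e = v} = c ` {e \<in> edges G. h e = v}"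
    and c_four: "k = 4 \<Longrightarrow> c ` {e \<in> edges G. t e = v} \<notin> {{0, 2}, {1, 3}}" if "v \<in> verts G" for v
    using bspec[OF c(2) that] by blast+
  define \<alpha> where "\<alpha> e = 2 * c e + (if e \<in> S then 1 else 2)" for e
  have \<alpha>_div: "(\<alpha> e - 1) div 2 = c e" for e by (simp add: \<alpha>_def)
  have \<alpha>_odd: "odd (\<alpha> e) \<longleftrightarrow> e \<in> S" for e by (simp add: \<alpha>_def)
  have proper: "proper_edge_coloring G (2 * k) \<alpha>"
    unfolding proper_edge_coloring_def
  proof (intro conjI ballI allI impI)
    show "\<alpha> e \<in> {1..2 * k}" if "e \<in> edges G" for e using c_less[OF that] by (auto simp: \<alpha>_def)
    fix e e' assume adj: "adjacent_edges G e e'"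
    then obtain v where v: "v \<in> ends G e" "v \<in> ends G e'"
      and e: "e \<in> edges G" "e' \<in> edges G" "e \<noteq> e'" unfolding adjacent_edges_def by blast
    have "v \<in> verts G" using v(1) e(1) ends_subset by blast
    note fib[OF this] c_inj[OF this]
    \<comment> \<open>Edges at \<open>v\<close> on the same side of \<open>S\<close> are all
      outgoing or all incoming, so their classes differ. Edges on different sides of
      \<open>S\<close> get colours of different parity.\<close>
    then have inj: "inj_on c (incident_edges G v \<inter> S)" "inj_on c (incident_edges G v - S)" by auto
    have ev: "e \<in> incident_edges G v" "e' \<in> incident_edges G v" using v e by (auto simp: incident_edges_def)
    show "\<alpha> e \<noteq> \<alpha> e'"
    proof
      assume eq: "\<alpha> e = \<alpha> e'"
      then have "c e = c e'" "e \<in> S \<longleftrightarrow> e' \<in> S" using \<alpha>_div \<alpha>_odd by metis+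
      then show False using inj_onD[OF inj(1), of e e'] inj_onD[OF inj(2), of e e'] ev e(3) by blast
    qed
  qed
  have "consecutive (colors_at G \<alpha> v) \<or> consecutive ({1..2 * k} - colors_at G \<alpha> v)" if v: "v \<in> verts G" for v
  proof -
    define D where "D = c ` {e \<in> edges G. t e = v}"
    \<comment> \<open>Outgoing and incoming edges at \<open>v\<close> carry the same classes, so
      each class in \<open>D\<close> occurs both inside and outside \<open>S\<close>, and its two
      colours both appear at \<open>v\<close>.\<close>
    have D: "c ` (incident_edges G v \<inter> S) = D" "c ` (incident_edges G v - S) = D"
      using fib[OF v] c_img[OF v] by (auto simp: D_def)
    have "colors_at G \<alpha> v = {m. 0 < m \<and> (m - 1) div 2 \<in> D}"
    proof (intro set_eqI iffI)
      fix m assume "m \<in> colors_at G \<alpha> v"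
      then obtain e where "e \<in> incident_edges G v" "m = \<alpha> e" by (auto simp: colors_at_def)
      moreover from this have "c e \<in> D" using D by (cases "e \<in> S") auto
      ultimately show "m \<in> {m. 0 < m \<and> (m - 1) div 2 \<in> D}" using \<alpha>_div[of e] by (simp add: \<alpha>_def)
    next
      fix m assume m: "m \<in> {m. 0 < m \<and> (m - 1) div 2 \<in> D}"
      obtain e where e: "e \<in> incident_edges G v" "c e = (m - 1) div 2" "e \<in> S \<longleftrightarrow> odd m"
      proof (cases "odd m")
        case True
        have "(m - 1) div 2 \<in> c ` (incident_edges G v \<inter> S)" using m D by simp
        then show ?thesis using that True by fastforce
      next
        case False
        have "(m - 1) div 2 \<in> c ` (incident_edges G v - S)" using m D by simp
        then show ?thesis using that False by fastforce
      qed
      have "\<alpha> e = m"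
      proof (cases "odd m")
        case True then show ?thesis using e by (simp add: \<alpha>_def)
      next
        case False
        \<comment> \<open>As \<open>m\<close> is positive, \<open>n > 0\<close> and
          \<open>(m - 1) div 2 = n - 1\<close>, so the colour \<open>2 * (n - 1) + 2\<close> is
          \<open>m\<close> again.\<close>
        then obtain n where "m = 2 * n" by blast
        then show ?thesis using e m False by (cases n) (simp_all add: \<alpha>_def)
      qed
      then show "m \<in> colors_at G \<alpha> v" using e(1) by (auto simp: colors_at_def)
    qed
    moreover have "D \<subseteq> {..<k}" using c_less by (auto simp: D_def)
    ultimately show ?thesis
      using consecutive_color_pairs[OF _ \<open>k \<le> 4\<close>, of D] c_four[OF v] by (simp add: D_def)
  qed
  then show ?thesis using proper k unfolding cyclic_interval_coloring_def by auto
qed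

end
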